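(* For every integer $n\ge1$, $$\det(N_n;\mathbb N_n,1)=(-1)^{\binom n2}a^n[n]_{t,u}!\prod_{m=1}^{n-1}\prod_{k=1}^{n-m}\bigl(1-az^{k-1}[m]_z\bigr),$$ where $\mathbb N_n=\frac{(n+1)(n+2)}2$.
   Context: $[n]_{p,q}=\frac{p^n-q^n}{p-q}$, $[n]_z=[n]_{1,z}$ (so $[0]_z=0$), $[n]_{t,u}!=\prod_{m=1}^n[m]_{t,u}$. For $n\ge0$, $N_n$ is the $\mathbb N_n\times\mathbb N_n$ matrix with entries in $\mathbb Z[a,z,t,u]$ whose rows and columns are indexed by pairs $(i,j)$ with $1\le j\le i\le n+1$, the pair $(i,j)$ in position $\frac{i(i-1)}2+j$, with entries $N_n[(i,j),(i,j)]=1-az^{j-1}[i-j]_z$; $N_n[(i,j),(i,j+1)]=-az^{j-1}[i-j]_z$ for $1\le j\le i-1$; $N_n[(i,j),(i+1,j)]=N_n[(i,j),(i+1,j+1)]=-a[i]_{t,u}$ for $i\le n$; all other entries $0$. (Equivalently $N_n=I-aA$, with $A$ the weighted adjacency matrix of the digraph on $\{(p,q)\in\mathbb N^2:p+q\le n\}$ with edges $(p,q)\to(p,q+1),(p+1,q)$ of weight $[p+q+1]_{t,u}$ and $(p,q)\to(p,q)$ ($q>0$), $(p+1,q-1)$ of weight $z^p[q]_z$.) $(B;r,c)$ denotes $B$ with row $r$ and column $c$ deleted. *)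

theory Defs
  imports
    "HOL-Computational_Algebra.Polynomial"
    "Jordan_Normal_Form.Determinant"
begin

text \<open>
  The ring \<open>\<int>[a,z,t,u]\<close> is realised as the iterated polynomial ring \<open>\<int>[a][z][t][u]\<close>;
  the innermost polynomial variable is \<open>a\<close>, the outermost one is \<open>u\<close>.
\<close>

type_synonym zaztu = "int poly poly poly poly"

definition var_a :: zaztu where "var_a = [:[:[:[:0, 1:]:]:]:]"
definition var_z :: zaztu where "var_z = [:[:[:0, 1:]:]:]"
definition var_t :: zaztu where "var_t = [:[:0, 1:]:]"
definition var_u :: zaztu where "var_u = [:0, 1:]"

text \<open>
  The quotient \<open>(p ^ n - q ^ n) / (p - q)\<close> is an exact division in the ring whenever
  \<open>p \<noteq> q\<close>, see \<open>pq_num_mult\<close> and \<open>pq_num_eq_sum\<close> below.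
\<close>

definition pq_num :: "'a::idom_divide \<Rightarrow> 'a \<Rightarrow> nat \<Rightarrow> 'a" where
  "pq_num p q n = (p ^ n - q ^ n) div (p - q)"

abbreviation q_num :: "'a::idom_divide \<Rightarrow> nat \<Rightarrow> 'a" where
  "q_num z n \<equiv> pq_num 1 z n"

definition pq_fact :: "'a::idom_divide \<Rightarrow> 'a \<Rightarrow> nat \<Rightarrow> 'a" where
  "pq_fact t u n = (\<Prod>m = 1..n. pq_num t u m)"

lemma pq_num_eq_sum:
  assumes "p \<noteq> q"
  shows "pq_num p q n = (\<Sum>i<n. q ^ (n - Suc i) * p ^ i)"
  unfolding pq_num_def power_diff_sumr2 using assms by simp

lemma pq_num_mult:
  assumes "p \<noteq> q"
  shows "(p - q) * pq_num p q n = p ^ n - q ^ n"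
  by (simp only: pq_num_eq_sum[OF assms] power_diff_sumr2)

lemma one_neq_var_z: "1 \<noteq> var_z"
  by (simp add: var_z_def one_pCons)

lemma var_t_neq_var_u: "var_t \<noteq> var_u"
  by (simp add: var_t_def var_u_def)

definition NN :: "nat \<Rightarrow> nat" where
  "NN n = (n + 1) * (n + 2) div 2"

definition index_pairs :: "nat \<Rightarrow> (nat \<times> nat) set" where
  "index_pairs n = {(i, j). 1 \<le> j \<and> j \<le> i \<and> i \<le> n + 1}"

definition pair_pos :: "nat \<times> nat \<Rightarrow> nat" where
  "pair_pos = (\<lambda>(i, j). i * (i - 1) div 2 + j)"

definition pair_at :: "nat \<Rightarrow> nat \<Rightarrow> nat \<times> nat" where
  "pair_at n r = inv_into (index_pairs n) pair_pos r"

lemma NN_Suc: "NN (Suc n) = NN n + n + 2"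
proof -
  have "(Suc n + 1) * (Suc n + 2) = (n + 1) * (n + 2) + 2 * (n + 2)"
    by (simp add: algebra_simps)
  then show ?thesis by (simp add: NN_def)
qed

lemma bij_betw_pair_pos: "bij_betw pair_pos (index_pairs n) {1..NN n}"
proof (induction n)
  case 0
  have pairs: "index_pairs 0 = {(1, 1)}"
    by (auto simp: index_pairs_def)
  have range: "{1..NN 0} = {1}"
    by (simp add: NN_def)
  show ?case
    unfolding pairs range by (simp add: bij_betw_def pair_pos_def)
next
  case (Suc n)
  let ?row = "Pair (n + 2) ` {1..n + 2}"
  have pos: "pair_pos (n + 2, j) = NN n + j" for j
    unfolding pair_pos_def NN_def by (simp add: mult.commute[of "Suc n"])
  have "bij_betw pair_pos ?row {NN n + 1..NN n + n + 2}"
  proof (rule bij_betw_imageI)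
    show "inj_on pair_pos ?row"
      by (rule inj_onI) (auto simp only: image_iff pos prod.inject add_left_cancel)
    have "pair_pos ` ?row = (\<lambda>j. NN n + j) ` {1..n + 2}"
      unfolding image_image pos ..
    also have "\<dots> = {1 + NN n..n + 2 + NN n}"
      by (rule image_add_atLeastAtMost)
    finally show "pair_pos ` ?row = {NN n + 1..NN n + n + 2}"
      by (simp only: ac_simps)
  qed
  with Suc.IH have "bij_betw pair_pos (index_pairs n \<union> ?row)
      ({1..NN n} \<union> {NN n + 1..NN n + n + 2})"
    by (rule bij_betw_combine) auto
  moreover have "index_pairs n \<union> ?row = index_pairs (Suc n)"
    by (auto simp: index_pairs_def)
  moreover have "{1..NN n} \<union> {NN n + 1..NN n + n + 2} = {1..NN (Suc n)}"
    by (auto simp: NN_Suc)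
  ultimately show ?case by simp
qed

lemma pair_at_pos: "x \<in> index_pairs n \<Longrightarrow> pair_at n (pair_pos x) = x"
  unfolding pair_at_def using bij_betw_pair_pos[of n]
  by (auto simp: bij_betw_def)

definition N_entry ::
  "'a::idom_divide \<Rightarrow> 'a \<Rightarrow> 'a \<Rightarrow> 'a \<Rightarrow> nat \<Rightarrow> nat \<times> nat \<Rightarrow> nat \<times> nat \<Rightarrow> 'a" where
  "N_entry a z t u n = (\<lambda>(i, j) (i', j').
     if (i', j') = (i, j) then 1 - a * z ^ (j - 1) * q_num z (i - j)
     else if (i', j') = (i, j + 1) \<and> 1 \<le> j \<and> j \<le> i - 1 then - (a * z ^ (j - 1) * q_num z (i - j))
     else if ((i', j') = (i + 1, j) \<or> (i', j') = (i + 1, j + 1)) \<and> i \<le> n then - (a * pq_num t u i)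
     else 0)"

text \<open>
  Matrices of the library are indexed from 0, whereas \<^const>\<open>pair_pos\<close> counts from 1.
\<close>

definition N_mat :: "'a::idom_divide \<Rightarrow> 'a \<Rightarrow> 'a \<Rightarrow> 'a \<Rightarrow> nat \<Rightarrow> 'a mat" where
  "N_mat a z t u n = mat (NN n) (NN n)
     (\<lambda>(r, c). N_entry a z t u n (pair_at n (r + 1)) (pair_at n (c + 1)))"

definition del_row_col :: "'a mat \<Rightarrow> nat \<Rightarrow> nat \<Rightarrow> 'a mat" where
  "del_row_col B r c = mat_delete B (r - 1) (c - 1)"

end

theory Submission
  imports Defs
begin

text \<open>
  Ordered by \<^const>\<open>pair_pos\<close>, the matrix \<open>N\<close> is upper triangular, so \<open>det N\<close> is the product of
  its diagonal entries.  The system \<open>N v = \<Delta> e\<close>, with \<open>e\<close> the last unit vector and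
  \<open>\<Delta> = (\<Prod>m = 1..n. 1 - a z^(n - m) [m])\<close>, has an explicit solution \<open>v\<close> all of whose entries
  are products.  Multiplying by the adjugate and reading off the first entry gives
  \<open>det N * v\<^sub>1 = \<plusminus> \<Delta> * det (N; last, 1)\<close> with \<open>v\<^sub>1 = a^n [n]!\<close>, and \<open>\<Delta>\<close> can be cancelled.
\<close>

section \<open>q-numbers and the recurrences of the explicit solution\<close>

lemma pq_num_0 [simp]: "pq_num p q 0 = 0"
  by (simp add: pq_num_def)

text \<open>Multiplied by \<open>1 - z\<close>, both sides become \<open>1 - z ^ (m + n)\<close>; in
  a domain this factor cancels since \<open>z \<noteq> 1\<close>.\<close>

lemma q_num_add:
  assumes "z \<noteq> 1"
  shows "q_num z (m + n) = q_num z m + z ^ m * q_num z n"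
proof -
  have "(1 - z) * q_num z (m + n) = (1 - z) * (q_num z m + z ^ m * q_num z n)"
    using pq_num_mult[of 1 z] assms
    by (simp add: distrib_left mult.left_commute[of "1 - z"]) (simp add: algebra_simps power_add)
  then show ?thesis using assms by simp
qed

text \<open>
  The entry of the solution \<open>v\<close> at the pair \<open>(i, j) = (p + q + 1, p + 1)\<close>, where \<open>d = n - p - q\<close>.
\<close>

definition sol :: "'a::idom_divide \<Rightarrow> 'a \<Rightarrow> 'a \<Rightarrow> 'a \<Rightarrow> nat \<Rightarrow> nat \<Rightarrow> nat \<Rightarrow> 'a" where
  "sol a z t u p q d = a ^ (q + d) * (\<Prod>k<d. pq_num t u (p + q + Suc k)) *
     (\<Prod>k<q. z ^ (p + k)) * (\<Prod>k<q. q_num z (d + Suc k)) *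
     (\<Prod>k<p. 1 - a * z ^ k * q_num z (p + q + d - k))"

text \<open>For the rows with \<open>j < i = n + 1\<close>, which have no entries leading to a
  further level. From the left value to the right one, a factor
  \<open>a * z ^ p * q_num z (Suc r)\<close> is traded for the diagonal entry, which is the new
  factor \<open>k = p\<close>.\<close>

lemma sol_last_level:
  "(1 - a * z ^ p * q_num z (Suc r)) * sol a z t u p (Suc r) 0 =
     a * z ^ p * q_num z (Suc r) * sol a z t u (Suc p) r 0"
proof -
  have "(\<Prod>k<Suc r. z ^ (p + k)) = z ^ p * (\<Prod>k<r. z ^ (Suc p + k))"
    by (subst prod.lessThan_Suc_shift) simp
  then show ?thesis
    by (simp add: sol_def algebra_simps)
qed

text \<open>For the rows with \<open>j = i \<le> n\<close>. Up to a common factor the two summands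
  are \<open>c\<close> and \<open>1 - c\<close> with
  \<open>c = a * z ^ p * q_num z (Suc e)\<close>.\<close>

lemma sol_diagonal:
  "sol a z t u p 0 (Suc e) =
     a * pq_num t u (Suc p) * (sol a z t u p 1 e + sol a z t u (Suc p) 0 e)"
proof -
  have "(\<Prod>k<Suc e. pq_num t u (p + 0 + Suc k)) =
      pq_num t u (Suc p) * (\<Prod>k<e. pq_num t u (Suc p + Suc k))"
    by (subst prod.lessThan_Suc_shift) simp
  then show ?thesis
    by (simp add: sol_def algebra_simps)
qed

text \<open>For the generic rows with \<open>j < i \<le> n\<close>, where all four kinds of entries
  occur.\<close>

lemma sol_interior:
  fixes z :: "'a::idom_divide"
  assumes "z \<noteq> 1"
  shows "(1 - a * z ^ p * q_num z (Suc r)) * sol a z t u p (Suc r) (Suc e) =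
     a * z ^ p * q_num z (Suc r) * sol a z t u (Suc p) r (Suc e) +
     a * pq_num t u (p + Suc (Suc r)) *
       (sol a z t u p (Suc (Suc r)) e + sol a z t u (Suc p) (Suc r) e)"
proof -
  define U where "U = (\<Prod>k<e. pq_num t u (p + Suc (Suc r) + Suc k))"
  define Z where "Z = (\<Prod>k<r. z ^ (Suc p + k))"
  define B where "B = (\<Prod>k<r. q_num z (e + Suc (Suc k)))"
  define S where "S = (\<Prod>k<p. 1 - a * z ^ k * q_num z (Suc (Suc (p + r + e)) - k))"
  define f where "f = pq_num t u (p + Suc (Suc r))"
  define X where "X = q_num z (Suc r)"
  define Y where "Y = q_num z (Suc e)"
  define P where "P = z ^ p"
  define R where "R = z ^ Suc r"
  \<comment> \<open>The only relation needed among the three q-numbers involved; it makes the claim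
    a ring identity in the abbreviations.\<close>
  have XY: "q_num z (Suc (Suc (r + e))) = X + R * Y"
    using q_num_add[OF assms, of "Suc r" "Suc e"] by (simp add: X_def Y_def R_def)
  have U1: "(\<Prod>k<Suc e. pq_num t u (p + Suc r + Suc k)) = f * U"
    by (subst prod.lessThan_Suc_shift) (simp add: U_def f_def)
  have Z1: "(\<Prod>k<Suc r. z ^ (p + k)) = P * Z"
    by (subst prod.lessThan_Suc_shift) (simp add: Z_def P_def)
  have Z2: "(\<Prod>k<Suc (Suc r). z ^ (p + k)) = P * Z * (P * R)"
    by (subst prod.lessThan_Suc) (simp only: Z1, simp add: P_def R_def power_add mult_ac)
  have Z3: "(\<Prod>k<Suc r. z ^ (Suc p + k)) = Z * (P * R)"
    by (subst prod.lessThan_Suc) (simp only: Z_def[symmetric], simp add: P_def R_def power_add mult_ac)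
  have B1: "(\<Prod>k<Suc r. q_num z (Suc e + Suc k)) = B * (X + R * Y)"
    using XY by (simp add: B_def add.commute)
  have B2: "(\<Prod>k<Suc r. q_num z (e + Suc k)) = Y * B"
    by (subst prod.lessThan_Suc_shift) (simp add: B_def Y_def)
  have B3: "(\<Prod>k<Suc (Suc r). q_num z (e + Suc k)) = Y * B * (X + R * Y)"
    using XY by (subst prod.lessThan_Suc) (simp only: B2, simp add: add.commute)
  have S1: "(\<Prod>k<Suc p. 1 - a * z ^ k * q_num z (Suc (Suc (p + r + e)) - k)) =
      S * (1 - a * P * (X + R * Y))"
    using XY by (simp add: S_def P_def Suc_diff_le)
  have W1: "sol a z t u p (Suc r) (Suc e) =
      a ^ (r + e) * a * a * (f * U) * (P * Z) * (B * (X + R * Y)) * S"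
    unfolding sol_def U1 Z1 B1 by (simp add: S_def)
  have W2: "sol a z t u (Suc p) r (Suc e) =
      a ^ (r + e) * a * (f * U) * Z * B * (S * (1 - a * P * (X + R * Y)))"
    using U1 S1 by (simp add: sol_def Z_def B_def)
  have W3: "sol a z t u p (Suc (Suc r)) e =
      a ^ (r + e) * a * a * U * (P * Z * (P * R)) * (Y * B * (X + R * Y)) * S"
    unfolding sol_def Z2 B3 by (simp add: S_def U_def)
  have W4: "sol a z t u (Suc p) (Suc r) e =
      a ^ (r + e) * a * U * (Z * (P * R)) * (Y * B) * (S * (1 - a * P * (X + R * Y)))"
    unfolding sol_def Z3 B2 using S1 by (simp add: U_def)
  \<comment> \<open>With \<open>T = X + R * Y\<close> and the common factor removed, the claim reads
    \<open>(1 - a*P*X) * T = X * (1 - a*P*T) + a*P*R*Y*T + R*Y * (1 - a*P*T)\<close>.\<close>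
  show ?thesis
    unfolding W1 W2 W3 W4 f_def[symmetric] X_def[symmetric] P_def[symmetric]
    by (simp only: algebra_simps)
qed

section \<open>The rows of \<open>N\<close> applied to the solution\<close>

definition sol_at :: "'a::idom_divide \<Rightarrow> 'a \<Rightarrow> 'a \<Rightarrow> 'a \<Rightarrow> nat \<Rightarrow> nat \<times> nat \<Rightarrow> 'a" where
  "sol_at a z t u n = (\<lambda>(i, j). sol a z t u (j - 1) (i - j) (Suc n - i))"

lemma finite_index_pairs [simp]: "finite (index_pairs n)"
  by (rule finite_subset[of _ "{..n + 1} \<times> {..n + 1}"]) (auto simp: index_pairs_def)

text \<open>The guards hold exactly when the respective neighbours of \<open>(i, j)\<close> lie in
  the index set, so no value of \<open>v\<close> outside it enters.\<close>

lemma sum_N_entry: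
  assumes "(i, j) \<in> index_pairs n"
  shows "(\<Sum>y\<in>index_pairs n. N_entry a z t u n (i, j) y * v y) =
    (1 - a * z ^ (j - 1) * q_num z (i - j)) * v (i, j)
    - (if j < i then a * z ^ (j - 1) * q_num z (i - j) * v (i, Suc j) else 0)
    - (if i \<le> n then a * pq_num t u i * (v (Suc i, j) + v (Suc i, Suc j)) else 0)"
proof -
  define c where "c = a * z ^ (j - 1) * q_num z (i - j)"
  define f where "f = a * pq_num t u i"
  have ij: "1 \<le> j" "j \<le> i" "i \<le> n + 1"
    using assms by (auto simp: index_pairs_def)
  have "j \<le> i - 1 \<longleftrightarrow> j < i"
    using ij by auto
  then have entry: "N_entry a z t u n (i, j) y =
      (if y = (i, j) then 1 - c else if y = (i, Suc j) \<and> j < i then - c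
       else if (y = (Suc i, j) \<or> y = (Suc i, Suc j)) \<and> i \<le> n then - f else 0)" for y
    using ij by (cases y) (simp only: N_entry_def prod.case c_def[symmetric] f_def[symmetric], auto)
  \<comment> \<open>The four target pairs are distinct, so the nested cases split into one-point
    functions that \<open>sum.delta\<close> evaluates.\<close>
  have "(\<Sum>y\<in>index_pairs n. N_entry a z t u n (i, j) y * v y) =
      (\<Sum>y\<in>index_pairs n.
        (if y = (i, j) then (1 - c) * v (i, j) else 0)
        - (if y = (i, Suc j) then if j < i then c * v (i, Suc j) else 0 else 0)
        - (if y = (Suc i, j) then if i \<le> n then f * v (Suc i, j) else 0 else 0)
        - (if y = (Suc i, Suc j) then if i \<le> n then f * v (Suc i, Suc j) else 0 else 0))"
    by (rule sum.cong) (simp_all add: entry)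
  also have "\<dots> = (1 - c) * v (i, j) - (if j < i then c * v (i, Suc j) else 0)
    - (if i \<le> n then f * v (Suc i, j) else 0) - (if i \<le> n then f * v (Suc i, Suc j) else 0)"
  proof -
    have "(i, Suc j) \<in> index_pairs n \<longleftrightarrow> j < i" "(Suc i, j) \<in> index_pairs n \<longleftrightarrow> i \<le> n"
      "(Suc i, Suc j) \<in> index_pairs n \<longleftrightarrow> i \<le> n"
      using ij by (auto simp: index_pairs_def)
    then show ?thesis
      using assms by (simp only: sum_subtractf sum.delta finite_index_pairs) simp
  qed
  finally show ?thesis by (simp add: c_def f_def distrib_left)
qed

text \<open>This is \<open>\<Delta>\<close>, with \<open>k = n - m\<close>: the product of the
  diagonal entries with \<open>i = n + 1\<close>, and also the solution's value at
  \<open>(n + 1, n + 1)\<close>.\<close>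

definition last_level_prod :: "'a::idom_divide \<Rightarrow> 'a \<Rightarrow> nat \<Rightarrow> 'a" where
  "last_level_prod a z n = (\<Prod>k<n. 1 - a * z ^ k * q_num z (n - k))"

lemma sum_N_entry_sol:
  fixes z :: "'a::idom_divide"
  assumes z: "z \<noteq> 1" and x: "x \<in> index_pairs n"
  shows "(\<Sum>y\<in>index_pairs n. N_entry a z t u n x y * sol_at a z t u n y) =
    (if x = (n + 1, n + 1) then last_level_prod a z n else 0)"
proof -
  obtain i j where xij: "x = (i, j)" by (cases x)
  have ij: "1 \<le> j" "j \<le> i" "i \<le> n + 1"
    using x xij by (auto simp: index_pairs_def)
  \<comment> \<open>The coordinates \<open>p\<close>, \<open>q\<close>, \<open>d\<close> remove
    truncated subtraction. Three of the four cases for \<open>q\<close> and \<open>d\<close> being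
    zero or not are the recurrences above; \<open>q = d = 0\<close> is the last row, whose diagonal
    entry is 1.\<close>
  obtain p where p: "j = Suc p" using ij(1) by (cases j) auto
  obtain q where q: "i = Suc (p + q)" using ij(2) p by (auto simp: le_iff_add)
  obtain d where d: "n = p + q + d" using ij(3) q by (auto simp: le_iff_add)
  show ?thesis
    unfolding xij sum_N_entry[OF x[unfolded xij]]
  proof (cases q)
    case 0
    then show "(1 - a * z ^ (j - 1) * q_num z (i - j)) * sol_at a z t u n (i, j)
      - (if j < i then a * z ^ (j - 1) * q_num z (i - j) * sol_at a z t u n (i, Suc j) else 0)
      - (if i \<le> n then a * pq_num t u i *
          (sol_at a z t u n (Suc i, j) + sol_at a z t u n (Suc i, Suc j)) else 0) =
      (if (i, j) = (n + 1, n + 1) then last_level_prod a z n else 0)"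
      by (cases d) (simp_all add: p q d sol_at_def sol_diagonal,
        simp add: sol_def last_level_prod_def)
  next
    case (Suc r)
    then show "(1 - a * z ^ (j - 1) * q_num z (i - j)) * sol_at a z t u n (i, j)
      - (if j < i then a * z ^ (j - 1) * q_num z (i - j) * sol_at a z t u n (i, Suc j) else 0)
      - (if i \<le> n then a * pq_num t u i *
          (sol_at a z t u n (Suc i, j) + sol_at a z t u n (Suc i, Suc j)) else 0) =
      (if (i, j) = (n + 1, n + 1) then last_level_prod a z n else 0)"
      using sol_interior[OF z, of a p r t u] sol_last_level[of a z p r t u]
      by (cases d) (simp_all add: p q d sol_at_def)
  qed
qed

section \<open>Matrix indices, triangularity and the determinant of \<open>N\<close>\<close>

lemma pair_pos_pair_at: "r < NN n \<Longrightarrow> pair_pos (pair_at n (Suc r)) = Suc r"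
  using bij_betw_pair_pos[of n] unfolding pair_at_def
  by (auto simp: bij_betw_def intro!: f_inv_into_f)

lemma bij_betw_pair_at: "bij_betw (\<lambda>r. pair_at n (Suc r)) {..<NN n} (index_pairs n)"
proof -
  have "bij_betw Suc {..<NN n} {1..NN n}"
    by (rule bij_betw_byWitness[where f' = "\<lambda>k. k - 1"]) auto
  moreover have "bij_betw (pair_at n) {1..NN n} (index_pairs n)"
    unfolding pair_at_def[abs_def] by (rule bij_betw_inv_into[OF bij_betw_pair_pos])
  ultimately show ?thesis
    using bij_betw_trans[of Suc] by (simp add: o_def)
qed

lemma NN_pos [simp]: "0 < NN n"
  by (induction n) (simp_all add: NN_Suc, simp add: NN_def)

lemma pair_at_first: "pair_at n (Suc 0) = (1, 1)"
  using pair_at_pos[of "(1, 1)" n] by (simp add: pair_pos_def index_pairs_def)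

lemma pair_at_last: "pair_at n (NN n) = (n + 1, n + 1)"
proof -
  have "(n + 1) * (n + 2) = (n + 1) * n + 2 * (n + 1)"
    by simp
  then have "NN n = pair_pos (n + 1, n + 1)"
    by (simp add: pair_pos_def NN_def)
  then show ?thesis
    using pair_at_pos[of "(n + 1, n + 1)" n] by (simp add: index_pairs_def)
qed

lemma N_mat_carrier [simp]: "N_mat a z t u n \<in> carrier_mat (NN n) (NN n)"
  by (simp add: N_mat_def)

text \<open>Raising \<open>j\<close> by one advances the position by 1 and raising \<open>i\<close>
  by one advances it by \<open>i\<close>, so no nonzero entry lies below the diagonal.\<close>

lemma N_entry_nonzero_pair_pos:
  assumes "x \<in> index_pairs n" "N_entry a z t u n x y \<noteq> 0"
  shows "pair_pos x \<le> pair_pos y"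
proof -
  have row: "pair_pos (Suc i, j) = pair_pos (i, j) + i" for i j
  proof -
    have "Suc i * i = i * (i - 1) + 2 * i" by (cases i) simp_all
    then show ?thesis by (simp add: pair_pos_def)
  qed
  have col: "pair_pos (i, Suc j) = Suc (pair_pos (i, j))" for i j
    by (simp add: pair_pos_def)
  show ?thesis
    using assms by (auto simp: N_entry_def row col split: if_splits prod.splits)
qed

lemma det_N_mat:
  "det (N_mat a z t u n) = (\<Prod>(i, j)\<in>index_pairs n. 1 - a * z ^ (j - 1) * q_num z (i - j))"
proof -
  have "upper_triangular (N_mat a z t u n)"
  proof (rule upper_triangularI)
    fix r c assume rc: "c < r" "r < dim_row (N_mat a z t u n)"
    then have r: "r < NN n" and c: "c < NN n" by (auto simp: N_mat_def)
    have "pair_at n (Suc r) \<in> index_pairs n"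
      using bij_betwE[OF bij_betw_pair_at] r by auto
    then have "N_entry a z t u n (pair_at n (Suc r)) (pair_at n (Suc c)) = 0"
      using N_entry_nonzero_pair_pos[of "pair_at n (Suc r)"] pair_pos_pair_at r c rc(1)
      by (metis Suc_le_mono not_le)
    then show "N_mat a z t u n $$ (r, c) = 0"
      using r c by (simp add: N_mat_def)
  qed
  then have "det (N_mat a z t u n) = prod_list (diag_mat (N_mat a z t u n))"
    by (rule det_upper_triangular[OF _ N_mat_carrier])
  also have "\<dots> = (\<Prod>r<NN n. N_entry a z t u n (pair_at n (Suc r)) (pair_at n (Suc r)))"
    by (simp add: prod_list_diag_prod N_mat_def atLeast0LessThan)
  also have "\<dots> = (\<Prod>x\<in>index_pairs n. N_entry a z t u n x x)"
    by (rule prod.reindex_bij_betw[OF bij_betw_pair_at])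
  also have "\<dots> = (\<Prod>(i, j)\<in>index_pairs n. 1 - a * z ^ (j - 1) * q_num z (i - j))"
    by (rule prod.cong) (auto simp: N_entry_def)
  finally show ?thesis .
qed

lemma prod_index_pairs:
  "(\<Prod>(i, j)\<in>index_pairs n. 1 - a * z ^ (j - 1) * q_num z (i - j)) =
    last_level_prod a z n *
    (\<Prod>m = 1..n - 1. \<Prod>k = 1..n - m. 1 - a * z ^ (k - 1) * q_num z m)"
proof -
  let ?f = "\<lambda>m k. 1 - a * z ^ (k - 1) * q_num z m"
  \<comment> \<open>Pairs with \<open>i = j\<close> contribute 1, because
    \<open>q_num z 0 = 0\<close>.\<close>
  have "(\<Prod>(i, j)\<in>index_pairs n. ?f (i - j) j) =
      (\<Prod>(i, j)\<in>{(i, j). 1 \<le> j \<and> j < i \<and> i \<le> n + 1}. ?f (i - j) j)"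
  proof (rule prod.mono_neutral_right)
    have "fst x = snd x"
      if "x \<in> index_pairs n - {(i, j). 1 \<le> j \<and> j < i \<and> i \<le> n + 1}" for x
      using that by (auto simp: index_pairs_def)
    then show "\<forall>x\<in>index_pairs n - {(i, j). 1 \<le> j \<and> j < i \<and> i \<le> n + 1}.
        (case x of (i, j) \<Rightarrow> ?f (i - j) j) = 1"
      by fastforce
  qed (simp, auto simp: index_pairs_def)
  also have "\<dots> = (\<Prod>(m, k)\<in>(SIGMA m:{1..n}. {1..Suc n - m}). ?f m k)"
    by (rule prod.reindex_bij_witness[where i = "\<lambda>(m, k). (m + k, k)" and j = "\<lambda>(i, j). (i - j, j)"])
      auto
  also have "\<dots> = (\<Prod>m = 1..n. \<Prod>k = 1..Suc n - m. ?f m k)"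
    by (subst prod.Sigma) auto
  \<comment> \<open>With \<open>m = i - j\<close> and \<open>k = j\<close>, the largest
    \<open>k\<close> belongs to \<open>i = n + 1\<close>; these factors are split off to form
    \<open>\<Delta>\<close>.\<close>
  also have "\<dots> = (\<Prod>m = 1..n. ?f m (Suc n - m) * (\<Prod>k = 1..n - m. ?f m k))"
    by (rule prod.cong) (auto simp: Suc_diff_le mult.commute)
  also have "\<dots> = (\<Prod>m = 1..n. ?f m (Suc n - m)) * (\<Prod>m = 1..n. \<Prod>k = 1..n - m. ?f m k)"
    by (rule prod.distrib)
  also have "(\<Prod>m = 1..n. ?f m (Suc n - m)) = last_level_prod a z n"
    unfolding last_level_prod_def
    by (rule prod.reindex_bij_witness[where i = "\<lambda>k. n - k" and j = "\<lambda>m. n - m"]) auto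
  \<comment> \<open>For \<open>m = n\<close> the inner product is empty.\<close>
  also have "(\<Prod>m = 1..n. \<Prod>k = 1..n - m. ?f m k) = (\<Prod>m = 1..n - 1. \<Prod>k = 1..n - m. ?f m k)"
    by (rule prod.mono_neutral_right) auto
  finally show ?thesis .
qed

section \<open>From the linear system to the cofactor\<close>

lemma sol_at_first: "sol_at a z t u n (1, 1) = a ^ n * pq_fact t u n"
  by (simp add: sol_at_def sol_def pq_fact_def prod.atLeast1_atMost_eq)

lemma last_level_prod_cofactor:
  fixes z :: "'a::idom_divide"
  assumes z: "z \<noteq> 1"
  shows "last_level_prod a z n * cofactor (N_mat a z t u n) (NN n - 1) 0 =
    det (N_mat a z t u n) * (a ^ n * pq_fact t u n)"
proof -
  let ?N = "N_mat a z t u n" and ?v = "vec (NN n) (\<lambda>c. sol_at a z t u n (pair_at n (Suc c)))"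
  have Nv: "?N *\<^sub>v ?v = last_level_prod a z n \<cdot>\<^sub>v unit_vec (NN n) (NN n - 1)"
  proof (rule eq_vecI)
    fix r assume "r < dim_vec (last_level_prod a z n \<cdot>\<^sub>v unit_vec (NN n) (NN n - 1))"
    then have r: "r < NN n" by simp
    have x: "pair_at n (Suc r) \<in> index_pairs n"
      using bij_betwE[OF bij_betw_pair_at] r by auto
    have last: "pair_at n (Suc r) = (n + 1, n + 1) \<longleftrightarrow> r = NN n - 1"
      using pair_pos_pair_at[OF r] pair_pos_pair_at[of "NN n - 1" n] pair_at_last[of n] NN_pos[of n]
      by auto
    have "(?N *\<^sub>v ?v) $ r = (\<Sum>c<NN n. N_entry a z t u n (pair_at n (Suc r)) (pair_at n (Suc c)) *
        sol_at a z t u n (pair_at n (Suc c)))"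
      using r by (simp add: N_mat_def scalar_prod_def atLeast0LessThan)
    also have "\<dots> = (\<Sum>y\<in>index_pairs n. N_entry a z t u n (pair_at n (Suc r)) y * sol_at a z t u n y)"
      by (rule sum.reindex_bij_betw[OF bij_betw_pair_at])
    also have "\<dots> = (if r = NN n - 1 then last_level_prod a z n else 0)"
      using sum_N_entry_sol[OF z x] last by simp
    finally show "(?N *\<^sub>v ?v) $ r = (last_level_prod a z n \<cdot>\<^sub>v unit_vec (NN n) (NN n - 1)) $ r"
      using r by simp
  qed (simp add: N_mat_def)
  have adj: "adj_mat ?N \<in> carrier_mat (NN n) (NN n)" "adj_mat ?N * ?N = det ?N \<cdot>\<^sub>m 1\<^sub>m (NN n)"
    using adj_mat[OF N_mat_carrier[of a z t u n]] by auto
  have "adj_mat ?N *\<^sub>v (?N *\<^sub>v ?v) = (adj_mat ?N * ?N) *\<^sub>v ?v"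
    by (rule assoc_mult_mat_vec[symmetric, OF adj(1) N_mat_carrier]) simp
  also have "\<dots> = det ?N \<cdot>\<^sub>v ?v"
    unfolding adj(2) by (auto simp: scalar_prod_left_unit)
  finally have "(adj_mat ?N *\<^sub>v (last_level_prod a z n \<cdot>\<^sub>v unit_vec (NN n) (NN n - 1))) $ 0 =
      (det ?N \<cdot>\<^sub>v ?v) $ 0"
    unfolding Nv by simp
  \<comment> \<open>The adjugate is the transposed cofactor matrix, so its entry in the first row
    and last column is the cofactor of the last row and first column.\<close>
  moreover have "(adj_mat ?N *\<^sub>v (last_level_prod a z n \<cdot>\<^sub>v unit_vec (NN n) (NN n - 1))) $ 0 =
      last_level_prod a z n * cofactor ?N (NN n - 1) 0"
    using adj(1) by (simp add: N_mat_def adj_mat_def)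
  ultimately show ?thesis
    using sol_at_first[of a z t u n] by (simp add: pair_at_first)
qed

section \<open>Sign, cancellation and conclusion\<close>

text \<open>The sum is \<open>n * (n + 1)\<close>. Hence the cofactor sign, with zero-based row
  \<open>NN n - 1\<close> and column 0, agrees with the sign in the theorem.\<close>

lemma even_NN_choose: "even (NN n - 1 + (n choose 2))"
proof (induction n)
  case (Suc n)
  have "NN (Suc n) - 1 + (Suc n choose 2) = (NN n - 1 + (n choose 2)) + 2 * (n + 1)"
    using NN_pos[of n] by (simp add: NN_Suc numeral_2_eq_2)
  then show ?case using Suc by simp
qed (simp add: NN_def binomial_eq_0)

text \<open>A vanishing factor would make the indeterminate \<open>a\<close> a unit of the
  polynomial ring.\<close>

lemma last_level_prod_var_nonzero: "last_level_prod var_a z n \<noteq> 0"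
proof -
  have "1 - var_a * x \<noteq> 0" for x
  proof
    assume "1 - var_a * x = 0"
    then have "var_a dvd 1" by (metis dvd_triv_left eq_iff_diff_eq_0)
    then show False by (simp add: var_a_def is_unit_const_poly_iff is_unit_poly_iff)
  qed
  then show ?thesis
    by (simp add: last_level_prod_def mult.assoc)
qed

theorem theorem3p8:
  fixes n :: nat
  assumes "n \<ge> 1"
  shows "det (del_row_col (N_mat var_a var_z var_t var_u n) (NN n) 1) =
    (- 1) ^ (n choose 2) * var_a ^ n * pq_fact var_t var_u n *
    (\<Prod>m = 1..n - 1. \<Prod>k = 1..n - m. 1 - var_a * var_z ^ (k - 1) * q_num var_z m)"
proof -
  let ?D = "det (del_row_col (N_mat var_a var_z var_t var_u n) (NN n) 1)"
  let ?P = "\<Prod>m = 1..n - 1. \<Prod>k = 1..n - m. 1 - var_a * var_z ^ (k - 1) * q_num var_z m"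
  have "last_level_prod var_a var_z n * ((- 1) ^ (NN n - 1) * ?D) =
      last_level_prod var_a var_z n * (?P * (var_a ^ n * pq_fact var_t var_u n))"
    using last_level_prod_cofactor[OF one_neq_var_z[symmetric], of var_a n var_t var_u]
    unfolding det_N_mat prod_index_pairs
    by (simp only: cofactor_def del_row_col_def add_0_right diff_self_eq_0 mult.assoc)
  then have D: "(- 1) ^ (NN n - 1) * ?D = ?P * (var_a ^ n * pq_fact var_t var_u n)"
    using last_level_prod_var_nonzero by simp
  have sign: "(- 1) ^ (NN n - 1) = ((- 1) ^ (n choose 2) :: zaztu)"
    using even_NN_choose[of n] by (simp add: minus_one_power_iff)
  \<comment> \<open>The sign squares to 1, which moves it to the other side.\<close>
  have "?D = (- 1) ^ (n choose 2) * ((- 1) ^ (n choose 2) * ?D)"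
    by (simp add: mult.assoc[symmetric] power_add[symmetric] flip: mult_2)
  also have "\<dots> = (- 1) ^ (n choose 2) * (?P * (var_a ^ n * pq_fact var_t var_u n))"
    using D unfolding sign by simp
  finally show ?thesis
    by (simp only: mult_ac)
qed

end
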